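(* Let $G$ be an infinite group with a first-order structure in a language $L_G$, let $G\preceq H$, and let ${\cal A}\subseteq{\rm Def}(G)$ be a $d$-closed $G$-algebra and ${\cal B}\subseteq{\cal P}(H)$ a $d$-closed $H$-algebra such that $A^{\#}\in{\cal B}$ for every $A\in{\cal A}$ and $\{B\cap G:B\in{\cal B}\}={\cal A}$. Assume every minimal left ideal of the semigroup $(S({\cal B}),* )$ is a group. Then every Ellis group of $S({\cal A})$ is isomorphic to some (topologically) closed subgroup of an Ellis group of $S({\cal B})$.
   Context: $G\preceq H$ means $H$ is an elementary extension of $G$ in $L_G$. ${\rm Def}(G)$ is the family of subsets of $G$ definable in $G$ with parameters from $G$; for $A\in{\rm Def}(G)$ defined by an $L_G$-formula $\varphi(x)$ with parameters in $G$, $A^{\#}\subseteq H$ is the set defined by $\varphi(x)$ in $H$. For a group $K$, a $K$-algebra is a Boolean algebra of subsets of $K$ closed under left translation by elements of $K$; $S(\cdot)$ denotes its Stone space of ultrafilters, a $K$-flow under left translation. For an ultrafilter $p$ and a set $A$ in a $K$-algebra put $d_p(A)=\{g\in K:g^{-1}A\in p\}$; the algebra is $d$-closed if it is closed under every $d_p$. For a $d$-closed $K$-algebra ${\cal C}$, $S({\cal C})$ carries the operation $A\in p*q\iff d_q(A)\in p$; $(S({\cal C}),* )$ is a compact Hausdorff semigroup continuous in the first coordinate, isomorphic (as a flow and semigroup) to the Ellis semigroup of the flow $S({\cal C})$. A minimal left ideal is a minimal nonempty $I\subseteq S({\cal C})$ with $S({\cal C})*I\subseteq I$; the Ellis groups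 of $S({\cal C})$ are the groups $u*I$ where $I$ is a minimal left ideal and $u\in I$ is an idempotent ($u*u=u$). *)

theory Defs
  imports "HOL-Analysis.Sigma_Algebra" "HOL-Analysis.Abstract_Topology" "HOL-Algebra.Coset"
begin

section \<open>First-order structures, elementary extensions, definable sets\<close>

text \<open>A language is given by its function and relation symbols together with their arities;
  nullary function symbols are the constant symbols.\<close>

record ('f, 'r) language =
  funs :: "('f \<times> nat) set"
  rels :: "('r \<times> nat) set"

record ('a, 'f, 'r) fo_struct =
  univ :: "'a set"
  fint :: "'f \<Rightarrow> 'a list \<Rightarrow> 'a"
  rint :: "'r \<Rightarrow> 'a list \<Rightarrow> bool"

definition is_struct :: "('f, 'r) language \<Rightarrow> ('a, 'f, 'r) fo_struct \<Rightarrow> bool" where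
  "is_struct L M \<longleftrightarrow> univ M \<noteq> {} \<and>
     (\<forall>(f, n) \<in> funs L. \<forall>xs. length xs = n \<and> set xs \<subseteq> univ M \<longrightarrow> fint M f xs \<in> univ M)"

datatype 'f fo_term = Var nat | App 'f "'f fo_term list"

datatype ('f, 'r) fo_form =
    Eq "'f fo_term" "'f fo_term"
  | Rel 'r "'f fo_term list"
  | Neg "('f, 'r) fo_form"
  | And "('f, 'r) fo_form" "('f, 'r) fo_form"
  | Ex nat "('f, 'r) fo_form"

fun wf_term :: "('f, 'r) language \<Rightarrow> 'f fo_term \<Rightarrow> bool" where
  "wf_term L (Var n) \<longleftrightarrow> True"
| "wf_term L (App f ts) \<longleftrightarrow> (f, length ts) \<in> funs L \<and> (\<forall>t\<in>set ts. wf_term L t)"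

primrec wf_form :: "('f, 'r) language \<Rightarrow> ('f, 'r) fo_form \<Rightarrow> bool" where
  "wf_form L (Eq s t) \<longleftrightarrow> wf_term L s \<and> wf_term L t"
| "wf_form L (Rel r ts) \<longleftrightarrow> (r, length ts) \<in> rels L \<and> (\<forall>t\<in>set ts. wf_term L t)"
| "wf_form L (Neg \<phi>) \<longleftrightarrow> wf_form L \<phi>"
| "wf_form L (And \<phi> \<psi>) \<longleftrightarrow> wf_form L \<phi> \<and> wf_form L \<psi>"
| "wf_form L (Ex n \<phi>) \<longleftrightarrow> wf_form L \<phi>"

primrec eval_term :: "('a, 'f, 'r) fo_struct \<Rightarrow> (nat \<Rightarrow> 'a) \<Rightarrow> 'f fo_term \<Rightarrow> 'a" where
  "eval_term M e (Var n) = e n"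
| "eval_term M e (App f ts) = fint M f (map (eval_term M e) ts)"

primrec sat :: "('a, 'f, 'r) fo_struct \<Rightarrow> (nat \<Rightarrow> 'a) \<Rightarrow> ('f, 'r) fo_form \<Rightarrow> bool" where
  "sat M e (Eq s t) \<longleftrightarrow> eval_term M e s = eval_term M e t"
| "sat M e (Rel r ts) \<longleftrightarrow> rint M r (map (eval_term M e) ts)"
| "sat M e (Neg \<phi>) \<longleftrightarrow> \<not> sat M e \<phi>"
| "sat M e (And \<phi> \<psi>) \<longleftrightarrow> sat M e \<phi> \<and> sat M e \<psi>"
| "sat M e (Ex n \<phi>) \<longleftrightarrow> (\<exists>a\<in>univ M. sat M (e(n := a)) \<phi>)"

definition substruct ::
    "('f, 'r) language \<Rightarrow> ('a, 'f, 'r) fo_struct \<Rightarrow> ('a, 'f, 'r) fo_struct \<Rightarrow> bool" where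
  "substruct L M N \<longleftrightarrow> is_struct L M \<and> is_struct L N \<and> univ M \<subseteq> univ N \<and>
     (\<forall>(f, n) \<in> funs L. \<forall>xs. length xs = n \<and> set xs \<subseteq> univ M \<longrightarrow> fint N f xs = fint M f xs) \<and>
     (\<forall>(r, n) \<in> rels L. \<forall>xs. length xs = n \<and> set xs \<subseteq> univ M \<longrightarrow> rint N r xs = rint M r xs)"

definition elementary_ext ::
    "('f, 'r) language \<Rightarrow> ('a, 'f, 'r) fo_struct \<Rightarrow> ('a, 'f, 'r) fo_struct \<Rightarrow> bool" where
  "elementary_ext L M N \<longleftrightarrow> substruct L M N \<and>
     (\<forall>\<phi> e. wf_form L \<phi> \<and> range e \<subseteq> univ M \<longrightarrow> (sat M e \<phi> \<longleftrightarrow> sat N e \<phi>))"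

text \<open>The set defined by a formula in the variable \<open>0\<close>; the values of the assignment \<open>e\<close> at the
  other variables are the parameters.\<close>

definition defset ::
    "('a, 'f, 'r) fo_struct \<Rightarrow> (nat \<Rightarrow> 'a) \<Rightarrow> ('f, 'r) fo_form \<Rightarrow> 'a set" where
  "defset M e \<phi> = {x \<in> univ M. sat M (e(0 := x)) \<phi>}"

definition Def :: "('f, 'r) language \<Rightarrow> ('a, 'f, 'r) fo_struct \<Rightarrow> 'a set set" where
  "Def L M = {defset M e \<phi> | e \<phi>. wf_form L \<phi> \<and> range e \<subseteq> univ M}"

text \<open>\<open>sharp L M N A\<close> is $A^{\#}$. For \<open>N\<close> elementary over \<open>M\<close> it does not depend on the formula
  defining \<open>A\<close>: see \<open>sharp_defset\<close>.\<close>

definition sharp ::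
    "('f, 'r) language \<Rightarrow> ('a, 'f, 'r) fo_struct \<Rightarrow> ('a, 'f, 'r) fo_struct \<Rightarrow> 'a set \<Rightarrow> 'a set" where
  "sharp L M N A =
     (THE B. \<exists>e \<phi>. wf_form L \<phi> \<and> range e \<subseteq> univ M \<and> A = defset M e \<phi> \<and> B = defset N e \<phi>)"

primrec ren_term :: "(nat \<Rightarrow> nat) \<Rightarrow> 'f fo_term \<Rightarrow> 'f fo_term" where
  "ren_term \<rho> (Var n) = Var (\<rho> n)"
| "ren_term \<rho> (App f ts) = App f (map (ren_term \<rho>) ts)"

primrec ren_form :: "(nat \<Rightarrow> nat) \<Rightarrow> ('f, 'r) fo_form \<Rightarrow> ('f, 'r) fo_form" where
  "ren_form \<rho> (Eq s t) = Eq (ren_term \<rho> s) (ren_term \<rho> t)"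
| "ren_form \<rho> (Rel r ts) = Rel r (map (ren_term \<rho>) ts)"
| "ren_form \<rho> (Neg \<phi>) = Neg (ren_form \<rho> \<phi>)"
| "ren_form \<rho> (And \<phi> \<psi>) = And (ren_form \<rho> \<phi>) (ren_form \<rho> \<psi>)"
| "ren_form \<rho> (Ex n \<phi>) = Ex (\<rho> n) (ren_form \<rho> \<phi>)"

lemma wf_ren_term: "wf_term L t \<Longrightarrow> wf_term L (ren_term \<rho> t)"
  by (induction t) auto

lemma wf_ren_form: "wf_form L \<phi> \<Longrightarrow> wf_form L (ren_form \<rho> \<phi>)"
  by (induction \<phi>) (auto simp: wf_ren_term)

lemma eval_ren_term: "eval_term M e (ren_term \<rho> t) = eval_term M (\<lambda>n. e (\<rho> n)) t"
  by (induction t) (auto intro!: arg_cong[where f = "fint M _"])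

lemma sat_ren_form:
  assumes "inj \<rho>"
  shows "sat M e (ren_form \<rho> \<phi>) \<longleftrightarrow> sat M (\<lambda>n. e (\<rho> n)) \<phi>"
proof (induction \<phi> arbitrary: e)
  case (Ex n \<phi>)
  have "(\<lambda>k. (e(\<rho> n := a)) (\<rho> k)) = (\<lambda>k. e (\<rho> k))(n := a)" for a
    using assms by (auto simp: fun_eq_iff inj_def)
  then show ?case using Ex by simp
qed (simp_all add: eval_ren_term comp_def)

lemma defset_cong_elementary:
  fixes M N :: "('a, 'f, 'r) fo_struct"
  assumes NM: "elementary_ext L M N"
    and wf: "wf_form L \<phi>" "wf_form L \<psi>"
    and e: "range e \<subseteq> univ M" "range e' \<subseteq> univ M"
    and eq: "defset M e \<phi> = defset M e' \<psi>"
  shows "defset N e \<phi> = defset N e' \<psi>"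
proof -
  define \<rho> \<sigma> where "\<rho> n = 2 * n" and "\<sigma> n = (if n = 0 then 0 else 2 * n - 1)" for n :: nat
  define d where "d n = (if even n then e (n div 2) else e' (Suc n div 2))" for n
  have inj: "inj \<rho>" "inj \<sigma>"
    unfolding \<rho>_def \<sigma>_def inj_def by (simp_all, presburger)
  have d\<rho>: "(\<lambda>n. (d(0 := x)) (\<rho> n)) = e(0 := x)" for x
    by (auto simp: fun_eq_iff d_def \<rho>_def)
  have d\<sigma>: "(\<lambda>n. (d(0 := x)) (\<sigma> n)) = e'(0 := x)" for x
  proof
    fix n show "(d(0 := x)) (\<sigma> n) = (e'(0 := x)) n"
      by (cases n) (auto simp: d_def \<sigma>_def)
  qed
  have rd: "range d \<subseteq> univ M" using e by (auto simp: d_def)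
  define \<phi>' \<psi>' where "\<phi>' = ren_form \<rho> \<phi>" and "\<psi>' = ren_form \<sigma> \<psi>"
  define \<chi> where "\<chi> = And (Neg (Ex 0 (And \<phi>' (Neg \<psi>')))) (Neg (Ex 0 (And \<psi>' (Neg \<phi>'))))"
  have wf\<chi>: "wf_form L \<chi>" using wf by (simp add: \<chi>_def \<phi>'_def \<psi>'_def wf_ren_form)
  have sat\<chi>: "sat K d \<chi> \<longleftrightarrow> defset K e \<phi> = defset K e' \<psi>" for K :: "('a, 'f, 'r) fo_struct"
    unfolding \<chi>_def \<phi>'_def \<psi>'_def defset_def
    by (auto simp: sat_ren_form inj d\<rho> d\<sigma> simp del: fun_upd_apply)
  show ?thesis
    using NM wf\<chi> rd eq sat\<chi> unfolding elementary_ext_def by blast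
qed

lemma sharp_defset:
  assumes "elementary_ext L M N" "wf_form L \<phi>" "range e \<subseteq> univ M"
  shows "sharp L M N (defset M e \<phi>) = defset N e \<phi>"
  unfolding sharp_def
  by (rule the_equality) (use assms defset_cong_elementary[OF assms(1)] in blast)+

text \<open>The group carried by a structure \<open>M\<close> whose language contains the binary function symbol \<open>m\<close>
  for the multiplication.\<close>

definition struct_group :: "'f \<Rightarrow> ('a, 'f, 'r) fo_struct \<Rightarrow> 'a monoid" where
  "struct_group m M =
     \<lparr>carrier = univ M, mult = (\<lambda>x y. fint M m [x, y]),
      one = (THE e. e \<in> univ M \<and> (\<forall>x\<in>univ M. fint M m [e, x] = x \<and> fint M m [x, e] = x))\<rparr>"

section \<open>Algebras of subsets of a group and their Stone spaces\<close>

definition group_algebra :: "'a monoid \<Rightarrow> 'a set set \<Rightarrow> bool" where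
  "group_algebra K \<C> \<longleftrightarrow> Sigma_Algebra.algebra (carrier K) \<C> \<and>
     (\<forall>g\<in>carrier K. \<forall>A\<in>\<C>. g <#\<^bsub>K\<^esub> A \<in> \<C>)"

definition stone :: "'a monoid \<Rightarrow> 'a set set \<Rightarrow> 'a set set set" where
  "stone K \<C> = {p. p \<subseteq> \<C> \<and> {} \<notin> p \<and> (\<forall>A\<in>p. \<forall>B\<in>p. A \<inter> B \<in> p) \<and>
     (\<forall>A\<in>p. \<forall>B\<in>\<C>. A \<subseteq> B \<longrightarrow> B \<in> p) \<and> (\<forall>A\<in>\<C>. A \<in> p \<or> carrier K - A \<in> p)}"

definition stone_topology :: "'a monoid \<Rightarrow> 'a set set \<Rightarrow> 'a set set topology" where
  "stone_topology K \<C> = topology_generated_by ((\<lambda>A. {p \<in> stone K \<C>. A \<in> p}) ` \<C>)"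

definition dmap :: "'a monoid \<Rightarrow> 'a set set \<Rightarrow> 'a set \<Rightarrow> 'a set" where
  "dmap K p A = {g \<in> carrier K. inv\<^bsub>K\<^esub> g <#\<^bsub>K\<^esub> A \<in> p}"

definition d_closed_algebra :: "'a monoid \<Rightarrow> 'a set set \<Rightarrow> bool" where
  "d_closed_algebra K \<C> \<longleftrightarrow> group_algebra K \<C> \<and> (\<forall>p\<in>stone K \<C>. \<forall>A\<in>\<C>. dmap K p A \<in> \<C>)"

definition star :: "'a monoid \<Rightarrow> 'a set set \<Rightarrow> 'a set set \<Rightarrow> 'a set set \<Rightarrow> 'a set set" where
  "star K \<C> p q = {A \<in> \<C>. dmap K q A \<in> p}"

section \<open>Minimal left ideals and Ellis groups\<close>

definition left_ideal :: "'a monoid \<Rightarrow> 'a set set \<Rightarrow> 'a set set set \<Rightarrow> bool" where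
  "left_ideal K \<C> I \<longleftrightarrow> I \<noteq> {} \<and> I \<subseteq> stone K \<C> \<and> (\<forall>p\<in>stone K \<C>. \<forall>q\<in>I. star K \<C> p q \<in> I)"

definition minimal_left_ideal :: "'a monoid \<Rightarrow> 'a set set \<Rightarrow> 'a set set set \<Rightarrow> bool" where
  "minimal_left_ideal K \<C> I \<longleftrightarrow> left_ideal K \<C> I \<and> (\<forall>J. left_ideal K \<C> J \<and> J \<subseteq> I \<longrightarrow> J = I)"

definition ellis_group :: "'a monoid \<Rightarrow> 'a set set \<Rightarrow> 'a set set \<Rightarrow> 'a set set set \<Rightarrow> 'a set set monoid" where
  "ellis_group K \<C> u I = \<lparr>carrier = star K \<C> u ` I, mult = star K \<C>, one = u\<rparr>"

definition is_ellis_group :: "'a monoid \<Rightarrow> 'a set set \<Rightarrow> 'a set set monoid \<Rightarrow> bool" where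
  "is_ellis_group K \<C> E \<longleftrightarrow>
     (\<exists>I u. minimal_left_ideal K \<C> I \<and> u \<in> I \<and> star K \<C> u u = u \<and> E = ellis_group K \<C> u I)"

end

(* Tracing sets on G and lifting along # give a semigroup embedding p |-> emb p = {B. B Int G in p}
   of S(A) into S(B) and a map restr : S(B) -> S(A) with restr (emb p * x) = p * restr x. If v is the
   identity of a minimal left ideal J of S(B), which is a group by assumption, then
   phi p = emb p * v is a continuous homomorphism S(A) -> J. It kills the idempotent u, so an Ellis
   group u * I has the same image as the compact semigroup S(A), whence that image is closed. It is
   injective on u * I: if phi g = v then g * restr v = restr v, and multiplying by u on the right
   gives an element of I fixed by g, which forces g = u. *)

theory Submission
  imports Defs "HOL-Analysis.T1_Spaces"
begin

section \<open>The semigroup of ultrafilters of a d-closed algebra\<close>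

lemma (in group) inv_l_coset_eq:
  assumes "A \<subseteq> carrier G" "g \<in> carrier G"
  shows "inv g <# A = {x \<in> carrier G. g \<otimes> x \<in> A}"
proof -
  have "x \<in> inv g <# A" if "x \<in> carrier G" "g \<otimes> x \<in> A" for x
    using that assms by (auto simp: l_coset_def m_assoc[symmetric] intro!: bexI[of _ "g \<otimes> x"])
  then show ?thesis
    using assms by (fastforce simp: l_coset_def m_assoc[symmetric])
qed

locale d_algebra = group K for K (structure) +
  fixes C :: "'a set set"
  assumes d_closed: "d_closed_algebra K C"
begin

abbreviation star_op (infixl \<open>\<star>\<close> 70) where "p \<star> q \<equiv> star K C p q"

text \<open>The translate of \<open>A\<close> by the inverse of \<open>g\<close>, written as a
  preimage under left multiplication, so that it visibly commutes with the Boolean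
  operations.\<close>

abbreviation pull where "pull g A \<equiv> {x \<in> carrier K. g \<otimes> x \<in> A}"

sublocale algebra "carrier K" C
  using d_closed by (simp add: d_closed_algebra_def group_algebra_def)

declare Int [simp] compl_sets [simp]

lemma pull_in [simp]: "A \<in> C \<Longrightarrow> g \<in> carrier K \<Longrightarrow> pull g A \<in> C"
  using d_closed sets_into_space inv_l_coset_eq[of A g] inv_closed[of g]
  unfolding d_closed_algebra_def group_algebra_def by metis

lemma dmap_eq: "A \<in> C \<Longrightarrow> dmap K p A = {g \<in> carrier K. pull g A \<in> p}"
  using sets_into_space by (auto simp: dmap_def inv_l_coset_eq)

lemma dmap_in [simp]: "A \<in> C \<Longrightarrow> p \<in> stone K C \<Longrightarrow> dmap K p A \<in> C"
  using d_closed by (simp add: d_closed_algebra_def)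

section \<open>Ultrafilters of the algebra\<close>

lemma stone_Int: "p \<in> stone K C \<Longrightarrow> A \<in> C \<Longrightarrow> B \<in> C \<Longrightarrow> A \<inter> B \<in> p \<longleftrightarrow> A \<in> p \<and> B \<in> p"
  unfolding stone_def by (auto; meson Int_lower1 Int_lower2)

lemma stone_compl:
  assumes p: "p \<in> stone K C" and A: "A \<in> C"
  shows "carrier K - A \<in> p \<longleftrightarrow> A \<notin> p"
proof
  assume "carrier K - A \<in> p"
  moreover have "(carrier K - A) \<inter> A = {}" by auto
  ultimately show "A \<notin> p" using p unfolding stone_def by force
qed (use p A in \<open>auto simp: stone_def\<close>)

lemma stone_subset: "p \<in> stone K C \<Longrightarrow> A \<in> p \<Longrightarrow> A \<in> C"
  unfolding stone_def by auto

lemma stone_empty: "p \<in> stone K C \<Longrightarrow> {} \<notin> p"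
  unfolding stone_def by auto

lemma stone_carrier: "p \<in> stone K C \<Longrightarrow> carrier K \<in> p"
  using stone_compl[of p "{}"] stone_empty by auto

text \<open>An ultrafilter is a Boolean homomorphism from \<open>C\<close> to the truth values, a
  form that pulls back along homomorphisms. Upward closure is the case
  \<open>A \<inter> B = A\<close> of the third premise.\<close>

lemma stoneI:
  assumes "p \<subseteq> C" "{} \<notin> p"
    and Int: "\<And>A B. A \<in> C \<Longrightarrow> B \<in> C \<Longrightarrow> A \<inter> B \<in> p \<longleftrightarrow> A \<in> p \<and> B \<in> p"
    and "\<And>A. A \<in> C \<Longrightarrow> carrier K - A \<in> p \<longleftrightarrow> A \<notin> p"
  shows "p \<in> stone K C"
proof -
  have "B \<in> p" if "A \<in> p" "B \<in> C" "A \<subseteq> B" for A B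
    using Int[of A B] that assms(1) by (auto simp: Int_absorb2)
  moreover have "A \<in> p \<or> carrier K - A \<in> p" if "A \<in> C" for A
    using assms(4) that by blast
  moreover have "A \<inter> B \<in> p" if "A \<in> p" "B \<in> p" for A B
    using Int that assms(1) by (meson subsetD)
  ultimately show ?thesis using assms(1,2) by (simp add: stone_def)
qed

lemma stone_eqI:
  assumes "p \<in> stone K C" "q \<in> stone K C" "p \<subseteq> q"
  shows "p = q"
  using assms stone_compl stone_subset by blast

lemma principal_stone: "{A \<in> C. \<one> \<in> A} \<in> stone K C"
  by (rule stoneI) auto

text \<open>With the next two lemmas this makes \<open>dmap K q\<close> an endomorphism of the
  Boolean algebra \<open>C\<close>. The product \<open>p \<star> q\<close> is the preimage of
  \<open>p\<close> under it, hence again an ultrafilter.\<close>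

lemma dmap_Int:
  assumes "A \<in> C" "B \<in> C" "q \<in> stone K C"
  shows "dmap K q (A \<inter> B) = dmap K q A \<inter> dmap K q B"
proof -
  have "pull g (A \<inter> B) = pull g A \<inter> pull g B" for g by auto
  then show ?thesis using assms by (auto simp: dmap_eq stone_Int)
qed

lemma dmap_compl:
  assumes "A \<in> C" "q \<in> stone K C"
  shows "dmap K q (carrier K - A) = carrier K - dmap K q A"
proof -
  have "pull g (carrier K - A) = carrier K - pull g A" if "g \<in> carrier K" for g
    using that by auto
  then show ?thesis using assms by (auto simp: dmap_eq stone_compl)
qed

lemma dmap_empty: "q \<in> stone K C \<Longrightarrow> dmap K q {} = {}"
  by (auto simp: dmap_eq stone_empty)

lemma star_stone [simp]:
  assumes "p \<in> stone K C" "q \<in> stone K C"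
  shows "p \<star> q \<in> stone K C"
  by (rule stoneI)
    (use assms in \<open>auto simp: star_def dmap_Int dmap_compl dmap_empty stone_Int stone_compl stone_empty\<close>)

lemma mem_star: "A \<in> p \<star> q \<longleftrightarrow> A \<in> C \<and> dmap K q A \<in> p"
  by (simp add: star_def)

text \<open>Pulling back by \<open>g\<close> and then by \<open>h\<close> amounts to pulling back by
  \<open>g \<otimes> h\<close>, so both sides consist of the \<open>h\<close> for which the latter
  pullback of \<open>A\<close> is in \<open>q\<close>.\<close>

lemma dmap_pull:
  assumes "A \<in> C" "g \<in> carrier K"
  shows "dmap K q (pull g A) = pull g (dmap K q A)"
proof -
  have "pull h (pull g A) = pull (g \<otimes> h) A" if "h \<in> carrier K" for h
    using that assms by (auto simp: m_assoc)
  then show ?thesis using assms by (auto simp: dmap_eq)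
qed

text \<open>Since \<open>dmap K r\<close> commutes with translations, the product turns into
  composition of endomorphisms; associativity is inherited from there.\<close>

lemma dmap_star:
  assumes "A \<in> C" "q \<in> stone K C" "r \<in> stone K C"
  shows "dmap K (q \<star> r) A = dmap K q (dmap K r A)"
  using assms by (auto simp: dmap_eq[of _ "q \<star> r"] dmap_eq[of _ q] mem_star dmap_pull)

lemma star_assoc:
  assumes "p \<in> stone K C" "q \<in> stone K C" "r \<in> stone K C"
  shows "p \<star> q \<star> r = p \<star> (q \<star> r)"
  using assms by (auto simp: mem_star dmap_star)

subsection \<open>Topology\<close>

lemma topspace_stone [simp]: "topspace (stone_topology K C) = stone K C"
  unfolding stone_topology_def topology_generated_by_topspace using stone_carrier by blast

lemma openin_basic: "A \<in> C \<Longrightarrow> openin (stone_topology K C) {p \<in> stone K C. A \<in> p}"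
  unfolding stone_topology_def by (rule topology_generated_by_Basis) auto

text \<open>The basic sets of \<open>A\<close> and \<open>B\<close> meet in that of
  \<open>A \<inter> B\<close>, so the generating sets form a base. The induction also carries
  \<open>p \<in> stone K C\<close>, which the intersection case needs.\<close>

lemma openin_contains_basic:
  assumes "openin (stone_topology K C) U" "p \<in> U"
  shows "\<exists>A\<in>p. {q \<in> stone K C. A \<in> q} \<subseteq> U"
proof -
  have "generate_topology_on ((\<lambda>A. {p \<in> stone K C. A \<in> p}) ` C) U"
    using assms(1) openin_topology_generated_by unfolding stone_topology_def by blast
  then have "\<forall>p\<in>U. p \<in> stone K C \<and> (\<exists>A\<in>p. {q \<in> stone K C. A \<in> q} \<subseteq> U)"
  proof induction
    case (Int U V)
    show ?case
    proof
      fix p assume "p \<in> U \<inter> V"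
      then have p: "p \<in> stone K C" using Int.IH(1) by blast
      obtain A where A: "A \<in> p" "{q \<in> stone K C. A \<in> q} \<subseteq> U"
        using Int.IH(1) \<open>p \<in> U \<inter> V\<close> by (meson IntD1)
      obtain B where B: "B \<in> p" "{q \<in> stone K C. B \<in> q} \<subseteq> V"
        using Int.IH(2) \<open>p \<in> U \<inter> V\<close> by (meson IntD2)
      have AB: "A \<in> C" "B \<in> C" using p A(1) B(1) stone_subset by auto
      then have "A \<inter> B \<in> p" using p A(1) B(1) by (simp add: stone_Int)
      moreover have "{q \<in> stone K C. A \<inter> B \<in> q} \<subseteq> U \<inter> V"
        using A(2) B(2) AB by (auto simp: stone_Int)
      ultimately show "p \<in> stone K C \<and> (\<exists>A\<in>p. {q \<in> stone K C. A \<in> q} \<subseteq> U \<inter> V)"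
        using p by blast
    qed
  next
    case (UN \<K>)
    show ?case
    proof
      fix p assume "p \<in> \<Union>\<K>"
      then obtain U where "U \<in> \<K>" "p \<in> U" by blast
      then have "p \<in> stone K C \<and> (\<exists>A\<in>p. {q \<in> stone K C. A \<in> q} \<subseteq> U)" using UN.IH by blast
      then show "p \<in> stone K C \<and> (\<exists>A\<in>p. {q \<in> stone K C. A \<in> q} \<subseteq> \<Union>\<K>)"
        using \<open>U \<in> \<K>\<close> by (meson Union_upper subset_trans)
    qed
  qed auto
  with assms(2) show ?thesis by blast
qed

section \<open>Hausdorff separation and compactness\<close>

lemma Hausdorff_stone: "Hausdorff_space (stone_topology K C)"
  unfolding Hausdorff_space_def topspace_stone
proof (intro allI impI)
  fix p q assume pq: "p \<in> stone K C \<and> q \<in> stone K C \<and> p \<noteq> q"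
  then obtain A where A: "A \<in> p" "A \<notin> q" using stone_eqI by blast
  then have "A \<in> C" using pq stone_subset by blast
  then show "\<exists>U V. openin (stone_topology K C) U \<and> openin (stone_topology K C) V \<and>
      p \<in> U \<and> q \<in> V \<and> disjnt U V"
    using pq A openin_basic[of A] openin_basic[of "carrier K - A"]
    by (intro exI[of _ "{p \<in> stone K C. A \<in> p}"] exI[of _ "{p \<in> stone K C. carrier K - A \<in> p}"])
      (auto simp: disjnt_def stone_compl)
qed

text \<open>By Zorn's lemma \<open>F\<close> lies in a maximal subfamily of \<open>C\<close> with
  the finite intersection property, and maximality makes it an ultrafilter. The factor
  \<open>carrier K\<close> takes care of the empty \<open>E\<close>, whose intersection is the whole
  type.\<close>

lemma ultrafilter_extension:
  assumes "F \<subseteq> C" and fip: "\<And>E. finite E \<Longrightarrow> E \<subseteq> F \<Longrightarrow> carrier K \<inter> \<Inter>E \<noteq> {}"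
  shows "\<exists>p\<in>stone K C. F \<subseteq> p"
proof -
  define fip where "fip D \<longleftrightarrow> (\<forall>E. finite E \<and> E \<subseteq> D \<longrightarrow> carrier K \<inter> \<Inter>E \<noteq> {})" for D
  define \<Z> where "\<Z> = {D. F \<subseteq> D \<and> D \<subseteq> C \<and> fip D}"
  have "\<exists>M\<in>\<Z>. \<forall>X\<in>\<Z>. M \<subseteq> X \<longrightarrow> X = M"
  proof (rule subset_Zorn_nonempty)
    show "\<Z> \<noteq> {}" using assms by (auto simp: \<Z>_def fip_def)
    fix \<C> assume ne: "\<C> \<noteq> {}" and ch: "subset.chain \<Z> \<C>"
    have "carrier K \<inter> \<Inter>E \<noteq> {}" if E: "finite E" "E \<subseteq> \<Union>\<C>" for E
    proof -
      obtain D where "D \<in> \<C>" "E \<subseteq> D"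
        using finite_subset_Union_chain[OF E ne ch] by blast
      moreover have "D \<in> \<Z>" using ch \<open>D \<in> \<C>\<close> by (auto simp: subset.chain_def)
      ultimately show ?thesis using E by (auto simp: \<Z>_def fip_def)
    qed
    then have "fip (\<Union>\<C>)" by (simp add: fip_def)
    moreover have "\<forall>D\<in>\<C>. F \<subseteq> D \<and> D \<subseteq> C" using ch by (auto simp: \<Z>_def subset.chain_def)
    ultimately show "\<Union>\<C> \<in> \<Z>" using ne by (auto simp: \<Z>_def)
  qed
  then obtain p where p: "F \<subseteq> p" "p \<subseteq> C" "fip p"
    and max: "\<And>X. X \<in> \<Z> \<Longrightarrow> p \<subseteq> X \<Longrightarrow> X = p" by (auto simp: \<Z>_def)
  \<comment> \<open>Maximality in usable form: a set of \<open>C\<close> belongs to \<open>p\<close>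
    as soon as adding it keeps the finite intersection property. The ultrafilter laws below rest on
    this.\<close>
  have crit: "A \<in> p \<longleftrightarrow> (\<forall>E. finite E \<and> E \<subseteq> p \<longrightarrow> carrier K \<inter> \<Inter>E \<inter> A \<noteq> {})"
    if A: "A \<in> C" for A
  proof
    assume "A \<in> p"
    show "\<forall>E. finite E \<and> E \<subseteq> p \<longrightarrow> carrier K \<inter> \<Inter>E \<inter> A \<noteq> {}"
    proof (intro allI impI)
      fix E assume "finite E \<and> E \<subseteq> p"
      then have "carrier K \<inter> \<Inter>(insert A E) \<noteq> {}"
        using p(3) \<open>A \<in> p\<close> unfolding fip_def by (metis finite_insert insert_subset)
      then show "carrier K \<inter> \<Inter>E \<inter> A \<noteq> {}" by auto
    qed
  next
    assume *: "\<forall>E. finite E \<and> E \<subseteq> p \<longrightarrow> carrier K \<inter> \<Inter>E \<inter> A \<noteq> {}"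
    have "fip (insert A p)"
      unfolding fip_def
    proof (intro allI impI)
      fix E assume E: "finite E \<and> E \<subseteq> insert A p"
      then have "finite (E - {A}) \<and> E - {A} \<subseteq> p" by auto
      then have "carrier K \<inter> \<Inter>(E - {A}) \<inter> A \<noteq> {}" by (rule *[rule_format])
      then show "carrier K \<inter> \<Inter>E \<noteq> {}" by auto
    qed
    then have "insert A p \<in> \<Z>" using p A by (auto simp: \<Z>_def)
    then show "A \<in> p" using max by blast
  qed
  have up: "B \<in> p" if "A \<in> p" "A \<subseteq> B" "B \<in> C" for A B
    unfolding crit[OF that(3)]
  proof (intro allI impI)
    fix E assume "finite E \<and> E \<subseteq> p"
    moreover have "A \<in> C" using that(1) p(2) by auto
    ultimately have "carrier K \<inter> \<Inter>E \<inter> A \<noteq> {}" using crit[of A] that(1) by simp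
    then show "carrier K \<inter> \<Inter>E \<inter> B \<noteq> {}" using that(2) by auto
  qed
  have Int: "A \<inter> B \<in> p \<longleftrightarrow> A \<in> p \<and> B \<in> p" if AB: "A \<in> C" "B \<in> C" for A B
  proof
    assume "A \<inter> B \<in> p"
    then show "A \<in> p \<and> B \<in> p" using up AB by (meson Int_lower1 Int_lower2)
  next
    assume "A \<in> p \<and> B \<in> p"
    show "A \<inter> B \<in> p"
      unfolding crit[OF Int[OF AB]]
    proof (intro allI impI)
      fix E assume "finite E \<and> E \<subseteq> p"
      then have "carrier K \<inter> \<Inter>(insert A (insert B E)) \<noteq> {}"
        using \<open>A \<in> p \<and> B \<in> p\<close> p(3) unfolding fip_def by (metis finite_insert insert_subset)
      then show "carrier K \<inter> \<Inter>E \<inter> (A \<inter> B) \<noteq> {}" by auto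
    qed
  qed
  have empty: "{} \<notin> p" using crit[of "{}"] by blast
  have compl: "carrier K - A \<in> p \<longleftrightarrow> A \<notin> p" if A: "A \<in> C" for A
  proof
    assume "carrier K - A \<in> p"
    moreover have "(carrier K - A) \<inter> A = {}" by auto
    ultimately show "A \<notin> p" using Int[of "carrier K - A" A] empty A by auto
  next
    assume "A \<notin> p"
    \<comment> \<open>Intersections that include the members of \<open>E\<close> miss
      \<open>A\<close>, so the finite intersection property makes every finite \<open>E'\<close>
      meet the complement of \<open>A\<close>.\<close>
    then obtain E where E: "finite E" "E \<subseteq> p" "carrier K \<inter> \<Inter>E \<inter> A = {}" using crit[OF A] by blast
    show "carrier K - A \<in> p"
      unfolding crit[OF compl_sets[OF A]]
    proof (intro allI impI)
      fix E' assume "finite E' \<and> E' \<subseteq> p"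
      then have "carrier K \<inter> \<Inter>(E \<union> E') \<noteq> {}"
        using E p(3) unfolding fip_def by (metis finite_Un Un_least)
      then show "carrier K \<inter> \<Inter>E' \<inter> (carrier K - A) \<noteq> {}" using E(3) by auto
    qed
  qed
  have "p \<in> stone K C" by (rule stoneI) (use p empty Int compl in auto)
  with p(1) show ?thesis by blast
qed

text \<open>Primeness of ultrafilters, by which a finite cover of the group yields a finite cover of
  the Stone space.\<close>

lemma stone_Union:
  assumes "p \<in> stone K C" "finite E" "E \<subseteq> C" "\<Union>E \<in> p"
  shows "\<exists>A\<in>E. A \<in> p"
  using assms(2-)
proof induction
  case empty then show ?case using assms(1) stone_empty by auto
next
  case (insert A E)
  have "\<Union>E \<in> C" using insert by (simp add: finite_Union subset_eq)
  have *: "carrier K - (A \<union> \<Union>E) = (carrier K - A) \<inter> (carrier K - \<Union>E)" by auto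
  have "A \<in> p \<or> \<Union>E \<in> p"
    using insert.prems \<open>\<Union>E \<in> C\<close> assms(1) stone_compl[of p "A \<union> \<Union>E"]
      stone_Int[of p "carrier K - A" "carrier K - \<Union>E"] stone_compl[of p A] stone_compl[of p "\<Union>E"] *
    by auto
  then show ?case using insert by auto
qed

lemma compact_stone: "compact_space (stone_topology K C)"
  unfolding compact_space_alt topspace_stone
proof (intro allI impI)
  fix \<U> assume "(\<forall>U\<in>\<U>. openin (stone_topology K C) U) \<and> stone K C \<subseteq> \<Union>\<U>"
  then have op: "\<forall>U\<in>\<U>. openin (stone_topology K C) U" and cov: "stone K C \<subseteq> \<Union>\<U>" by blast+
  \<comment> \<open>Sets whose basic neighbourhood fits into one member of the cover. If no finitely
    many of them covered the group, their complements would extend to an ultrafilter containing none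
    of them, contrary to \<open>ex\<close>.\<close>
  define D where "D = {A \<in> C. \<exists>U\<in>\<U>. {q \<in> stone K C. A \<in> q} \<subseteq> U}"
  have ex: "\<exists>A\<in>D. A \<in> p" if p: "p \<in> stone K C" for p
  proof -
    obtain U where U: "U \<in> \<U>" "p \<in> U" using p cov by blast
    then obtain A where "A \<in> p" "{q \<in> stone K C. A \<in> q} \<subseteq> U"
      using op openin_contains_basic by meson
    then show ?thesis using U(1) stone_subset[OF p] by (auto simp: D_def)
  qed
  have "\<exists>E. finite E \<and> E \<subseteq> D \<and> \<Union>E = carrier K"
  proof (rule ccontr)
    assume no: "\<not> ?thesis"
    have "carrier K \<inter> \<Inter>E \<noteq> {}" if E: "finite E" "E \<subseteq> (\<lambda>A. carrier K - A) ` D" for E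
    proof -
      obtain E' where E': "E' \<subseteq> D" "finite E'" "E = (\<lambda>A. carrier K - A) ` E'"
        using finite_subset_image[OF E] by blast
      moreover have "\<Union>E' \<subseteq> carrier K" using E'(1) sets_into_space by (auto simp: D_def)
      ultimately obtain x where "x \<in> carrier K" "x \<notin> \<Union>E'" using no by blast
      then have "x \<in> carrier K \<inter> \<Inter>E" using E'(3) by simp
      then show ?thesis by blast
    qed
    moreover have "(\<lambda>A. carrier K - A) ` D \<subseteq> C" by (auto simp: D_def)
    ultimately obtain p where "p \<in> stone K C" "(\<lambda>A. carrier K - A) ` D \<subseteq> p"
      using ultrafilter_extension by metis
    obtain A where A: "A \<in> D" "A \<in> p" using ex[OF \<open>p \<in> stone K C\<close>] by auto
    then have "carrier K - A \<in> p" using \<open>_ ` D \<subseteq> p\<close> by auto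
    with A show False using stone_compl[OF \<open>p \<in> stone K C\<close>, of A] by (simp add: D_def)
  qed
  then obtain E where E: "finite E" "E \<subseteq> D" "\<Union>E = carrier K" by blast
  then have "\<forall>A\<in>E. \<exists>U\<in>\<U>. {q \<in> stone K C. A \<in> q} \<subseteq> U" by (auto simp: D_def)
  then obtain f where f: "\<And>A. A \<in> E \<Longrightarrow> f A \<in> \<U> \<and> {q \<in> stone K C. A \<in> q} \<subseteq> f A" by metis
  have "stone K C \<subseteq> \<Union>(f ` E)"
  proof
    fix p assume p: "p \<in> stone K C"
    then obtain A where "A \<in> E" "A \<in> p"
      using stone_Union[of p E] E stone_carrier by (auto simp: D_def)
    then show "p \<in> \<Union>(f ` E)" using f p by blast
  qed
  then show "\<exists>\<F>. finite \<F> \<and> \<F> \<subseteq> \<U> \<and> stone K C \<subseteq> \<Union>\<F>"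
    using E(1) f by (intro exI[of _ "f ` E"]) auto
qed

section \<open>Continuity of maps into the Stone space\<close>

lemma continuous_map_stoneI:
  assumes "\<And>p. p \<in> topspace X \<Longrightarrow> f p \<in> stone K C"
    and "\<And>A. A \<in> C \<Longrightarrow> openin X {p \<in> topspace X. A \<in> f p}"
  shows "continuous_map X (stone_topology K C) f"
  unfolding stone_topology_def
proof (rule continuous_on_generated_topo)
  fix U assume "U \<in> (\<lambda>A. {p \<in> stone K C. A \<in> p}) ` C"
  then obtain A where A: "A \<in> C" "U = {p \<in> stone K C. A \<in> p}" by blast
  then have "f -` U \<inter> topspace X = {p \<in> topspace X. A \<in> f p}" using assms(1) by auto
  with assms(2) A(1) show "openin X (f -` U \<inter> topspace X)" by simp
qed (use assms(1) stone_carrier in blast)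

text \<open>The preimage of the basic open set of \<open>A\<close> is the basic open set of
  \<open>dmap K q A\<close>, a member of the algebra by d-closedness.\<close>

lemma continuous_star_left:
  assumes "q \<in> stone K C"
  shows "continuous_map (stone_topology K C) (stone_topology K C) (\<lambda>p. p \<star> q)"
  by (rule continuous_map_stoneI) (use assms openin_basic in \<open>auto simp: mem_star\<close>)

subsection \<open>Minimal left ideals\<close>

lemma left_ideal_star:
  assumes "q \<in> stone K C"
  shows "left_ideal K C ((\<lambda>p. p \<star> q) ` stone K C)"
  unfolding left_ideal_def using assms principal_stone by (auto simp flip: star_assoc)

lemma left_ideal_right_mult:
  assumes "left_ideal K C I" "q \<in> stone K C"
  shows "left_ideal K C ((\<lambda>p. p \<star> q) ` I)"
  unfolding left_ideal_def
proof (intro conjI ballI)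
  fix p r assume "p \<in> stone K C" "r \<in> (\<lambda>p. p \<star> q) ` I"
  then obtain i where "i \<in> I" "r = i \<star> q" by blast
  then show "p \<star> r \<in> (\<lambda>p. p \<star> q) ` I"
    using assms \<open>p \<in> stone K C\<close> unfolding left_ideal_def
    by (intro image_eqI[of _ _ "p \<star> i"]) (auto simp: star_assoc subset_eq)
qed (use assms in \<open>auto simp: left_ideal_def\<close>)

lemma closedin_principal_left_ideal:
  assumes "q \<in> stone K C"
  shows "closedin (stone_topology K C) ((\<lambda>p. p \<star> q) ` stone K C)"
proof (rule compactin_imp_closedin[OF Hausdorff_stone])
  have "compactin (stone_topology K C) (stone K C)"
    using compact_stone by (simp add: compact_space_def)
  then show "compactin (stone_topology K C) ((\<lambda>p. p \<star> q) ` stone K C)"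
    using continuous_star_left[OF assms] image_compactin by blast
qed

text \<open>Zorn's lemma is applied to closed left ideals, where compactness keeps the intersection
  of a chain nonempty. A minimal closed one is minimal among all, since a left ideal containing
  \<open>q\<close> contains the closed left ideal of all products
  \<open>p \<star> q\<close>.\<close>

lemma minimal_left_ideal_exists: "\<exists>I. minimal_left_ideal K C I"
proof -
  let ?S = "stone K C"
  define \<Z> where "\<Z> = {I. left_ideal K C I \<and> closedin (stone_topology K C) I}"
  have sub: "I \<subseteq> ?S" if "I \<in> \<Z>" for I using that by (auto simp: \<Z>_def left_ideal_def)
  \<comment> \<open>Complements reverse inclusion, so a maximal element here is the complement of a
    minimal closed left ideal.\<close>
  have "\<exists>M\<in>(\<lambda>I. ?S - I) ` \<Z>. \<forall>X\<in>(\<lambda>I. ?S - I) ` \<Z>. M \<subseteq> X \<longrightarrow> X = M"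
  proof (rule subset_Zorn_nonempty)
    have "(\<lambda>p. p \<star> {A \<in> C. \<one> \<in> A}) ` ?S \<in> \<Z>"
      using left_ideal_star closedin_principal_left_ideal principal_stone by (auto simp: \<Z>_def)
    then show "(\<lambda>I. ?S - I) ` \<Z> \<noteq> {}" by blast
    fix \<C> assume ne: "\<C> \<noteq> {}" and ch: "subset.chain ((\<lambda>I. ?S - I) ` \<Z>) \<C>"
    then have "\<C> \<subseteq> (\<lambda>I. ?S - I) ` \<Z>" by (auto simp: subset.chain_def)
    then obtain \<D> where D: "\<D> \<subseteq> \<Z>" "\<C> = (\<lambda>I. ?S - I) ` \<D>" by (auto simp: subset_image_iff)
    then have "\<D> \<noteq> {}" using ne by blast
    have lin: "I \<subseteq> J \<or> J \<subseteq> I" if "I \<in> \<D>" "J \<in> \<D>" for I J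
    proof -
      have "?S - I \<subseteq> ?S - J \<or> ?S - J \<subseteq> ?S - I"
        using subset_chain_def[THEN iffD1, OF ch] that by (simp add: D(2))
      then show ?thesis using sub D(1) that by blast
    qed
    have "\<Inter>\<D> \<noteq> {}"
    proof -
      have "\<Inter>\<F> \<noteq> {}" if "finite \<F>" "\<F> \<subseteq> \<D>" for \<F>
      proof (cases "\<F> = {}")
        case False
        \<comment> \<open>A finite nonempty part of a chain has a least member, and that member lies
          in the intersection.\<close>
        have "\<exists>I\<in>\<F>. \<forall>J\<in>\<F>. I \<subseteq> J"
          using that(1) False that(2)
        proof (induction rule: finite_ne_induct)
          case (insert I \<F>)
          then obtain J where J: "J \<in> \<F>" "\<forall>X\<in>\<F>. J \<subseteq> X" by auto
          then have "I \<subseteq> J \<or> J \<subseteq> I" using lin insert.prems by auto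
          then show ?case using J by (metis insert_iff order.refl order.trans)
        qed auto
        then obtain I where "I \<in> \<F>" "I \<subseteq> \<Inter>\<F>" by blast
        moreover have "I \<noteq> {}" using \<open>I \<in> \<F>\<close> that D by (auto simp: \<Z>_def left_ideal_def)
        ultimately show ?thesis by blast
      qed simp
      moreover have "\<forall>I\<in>\<D>. closedin (stone_topology K C) I" using D(1) by (auto simp: \<Z>_def)
      ultimately show ?thesis
        using compact_space_fip[THEN iffD1, OF compact_stone, THEN spec, of \<D>] by meson
    qed
    moreover have "\<Inter>\<D> \<subseteq> ?S" using sub D(1) \<open>\<D> \<noteq> {}\<close> by blast
    moreover have "p \<star> q \<in> \<Inter>\<D>" if "p \<in> ?S" "q \<in> \<Inter>\<D>" for p q
    proof
      fix I assume "I \<in> \<D>"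
      then have "left_ideal K C I" "q \<in> I" using D(1) that(2) by (auto simp: \<Z>_def)
      then show "p \<star> q \<in> I" using that(1) by (simp add: left_ideal_def)
    qed
    ultimately have "left_ideal K C (\<Inter>\<D>)" by (simp add: left_ideal_def)
    moreover have "closedin (stone_topology K C) (\<Inter>\<D>)"
      using D(1) \<open>\<D> \<noteq> {}\<close> by (intro closedin_Inter) (auto simp: \<Z>_def)
    ultimately have "\<Inter>\<D> \<in> \<Z>" by (simp add: \<Z>_def)
    moreover have "\<Union>\<C> = ?S - \<Inter>\<D>" using D(2) by blast
    ultimately show "\<Union>\<C> \<in> (\<lambda>I. ?S - I) ` \<Z>" by blast
  qed
  then obtain I where I: "I \<in> \<Z>" and max: "\<forall>X\<in>(\<lambda>I. ?S - I) ` \<Z>. ?S - I \<subseteq> X \<longrightarrow> X = ?S - I"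
    by auto
  have min: "J = I" if "J \<in> \<Z>" "J \<subseteq> I" for J
  proof -
    have "?S - J = ?S - I" using max that by auto
    then show ?thesis using sub[OF that(1)] sub[OF I] by blast
  qed
  have "J = I" if J: "left_ideal K C J" "J \<subseteq> I" for J
  proof -
    obtain q where q: "q \<in> J" "q \<in> ?S" using J by (auto simp: left_ideal_def)
    let ?P = "(\<lambda>p. p \<star> q) ` ?S"
    have "?P \<subseteq> J" using J q by (auto simp: left_ideal_def)
    moreover have "?P = I"
      using min left_ideal_star closedin_principal_left_ideal q J \<open>?P \<subseteq> J\<close> unfolding \<Z>_def by blast
    ultimately show ?thesis using J by blast
  qed
  then show ?thesis using I unfolding minimal_left_ideal_def \<Z>_def by blast
qed

text \<open>Multiplying \<open>I\<close> by \<open>q\<close> on the right gives a left ideal inside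
  \<open>I\<close>, so minimality applies. This makes \<open>y \<star> q = x\<close> solvable in
  \<open>I\<close>.\<close>

lemma minimal_left_ideal_mult:
  assumes I: "minimal_left_ideal K C I" and q: "q \<in> I"
  shows "(\<lambda>p. p \<star> q) ` I = I"
proof -
  have q': "q \<in> stone K C" and left: "left_ideal K C I"
    using I q by (auto simp: minimal_left_ideal_def left_ideal_def)
  have "(\<lambda>p. p \<star> q) ` I \<subseteq> I" using left q unfolding left_ideal_def by blast
  then show ?thesis
    using I left_ideal_right_mult[OF left q'] unfolding minimal_left_ideal_def by blast
qed

lemma minimal_left_ideal_divide:
  assumes "minimal_left_ideal K C I" "q \<in> I" "x \<in> I"
  obtains y where "y \<in> I" "y \<star> q = x"
proof -
  have "x \<in> (\<lambda>p. p \<star> q) ` I" using minimal_left_ideal_mult[OF assms(1,2)] assms(3) by simp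
  then show thesis using that by auto
qed

section \<open>Ellis groups inside a minimal left ideal\<close>

lemma ellis_subset:
  assumes "minimal_left_ideal K C I" "u \<in> I"
  shows "star K C u ` I \<subseteq> I"
proof -
  have "u \<in> stone K C" "\<forall>q\<in>I. u \<star> q \<in> I"
    using assms by (auto simp: minimal_left_ideal_def left_ideal_def)
  then show ?thesis by auto
qed

text \<open>Every element of \<open>I\<close> has the form \<open>y \<star> u\<close>, and
  idempotence absorbs a second factor \<open>u\<close>.\<close>

lemma minimal_left_ideal_idem_right:
  assumes I: "minimal_left_ideal K C I" and u: "u \<in> I" "u \<star> u = u" and x: "x \<in> I"
  shows "x \<star> u = x"
proof -
  obtain y where "y \<in> I" "y \<star> u = x" using minimal_left_ideal_divide[OF I u(1) x] by metis
  then show ?thesis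
    using u I by (auto simp: star_assoc minimal_left_ideal_def left_ideal_def subset_eq)
qed

text \<open>Minimality solves \<open>y \<star> g = u\<close> in \<open>I\<close>. Multiplying
  \<open>y\<close> by \<open>u\<close> on the left moves it into the Ellis group and keeps the
  equation, as \<open>u\<close> is idempotent.\<close>

lemma ellis_left_inverse:
  assumes I: "minimal_left_ideal K C I" and u: "u \<in> I" "u \<star> u = u" and g: "g \<in> star K C u ` I"
  shows "\<exists>h\<in>star K C u ` I. h \<star> g = u"
proof -
  have sub: "I \<subseteq> stone K C"
    using I by (auto simp: minimal_left_ideal_def left_ideal_def)
  have "g \<in> I" using ellis_subset[OF I u(1)] g by auto
  then obtain y where "y \<in> I" "y \<star> g = u" using minimal_left_ideal_divide[OF I _ u(1)] by metis
  then have "u \<star> y \<star> g = u" using u \<open>g \<in> I\<close> sub by (auto simp: star_assoc subset_eq)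
  then show ?thesis using \<open>y \<in> I\<close> by blast
qed

text \<open>With \<open>y \<star> x = u\<close>, the element \<open>x \<star> y\<close> is an idempotent of \<open>I\<close>, hence a right identity of \<open>I\<close>,
  and \<open>g \<star> x = x\<close> forces \<open>g = x \<star> y\<close>.\<close>

lemma ellis_fixed_imp_one:
  assumes I: "minimal_left_ideal K C I" and u: "u \<in> I" "u \<star> u = u" and g: "g \<in> star K C u ` I"
    and x: "x \<in> I" "g \<star> x = x"
  shows "g = u"
proof -
  have sub: "\<And>p. p \<in> I \<Longrightarrow> p \<in> stone K C"
    and ideal: "\<And>p q. p \<in> stone K C \<Longrightarrow> q \<in> I \<Longrightarrow> p \<star> q \<in> I"
    using I by (auto simp: minimal_left_ideal_def left_ideal_def)
  have gI: "g \<in> I" using ellis_subset[OF I u(1)] g by auto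
  obtain y where y: "y \<in> I" "y \<star> x = u" using minimal_left_ideal_divide[OF I x(1) u(1)] by metis
  have xyI: "x \<star> y \<in> I" using ideal[OF sub[OF x(1)] y(1)] .
  have "(x \<star> y) \<star> (x \<star> y) = x \<star> (y \<star> x) \<star> y" using x(1) y(1) sub by (simp add: star_assoc)
  also have "\<dots> = x \<star> y" using minimal_left_ideal_idem_right[OF I u x(1)] y(2) by simp
  finally have idem: "(x \<star> y) \<star> (x \<star> y) = x \<star> y" .
  have "g = g \<star> (x \<star> y)" using minimal_left_ideal_idem_right[OF I xyI idem gI] by simp
  also have "\<dots> = x \<star> y" using x y gI sub by (simp flip: star_assoc)
  finally have gg: "g \<star> g = g" using idem by simp
  \<comment> \<open>Applying a left inverse \<open>h\<close> to \<open>g \<star> g = g\<close> turns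
    the left side into \<open>u \<star> g\<close>, which is \<open>g\<close>, and the right side
    into \<open>u\<close>.\<close>
  obtain h where h: "h \<in> star K C u ` I" "h \<star> g = u" using ellis_left_inverse[OF I u g] by blast
  then have hS: "h \<in> stone K C" using ellis_subset[OF I u(1)] sub by blast
  obtain z where "z \<in> I" "g = u \<star> z" using g by blast
  then have "u \<star> g = g" using u sub by (simp flip: star_assoc)
  then have "g = h \<star> g \<star> g" using h(2) by simp
  also have "\<dots> = h \<star> (g \<star> g)" using hS gI sub by (simp add: star_assoc)
  also have "\<dots> = u" using gg h(2) by simp
  finally show ?thesis .
qed

end


section \<open>Transferring ultrafilters along an extension of algebras\<close>

text \<open>The interface to first-order logic: \<open>s\<close> plays the role of
  \<open>sharp\<close>, as a Boolean homomorphism that commutes with translations by elements of the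
  smaller group.\<close>

locale d_algebra_extension = G: d_algebra G A + H: d_algebra H B
  for G :: "'a monoid" and A and H :: "'a monoid" and B +
  fixes s :: "'a set \<Rightarrow> 'a set"
  assumes carrier_subset: "carrier G \<subseteq> carrier H"
    and mult_eq: "x \<in> carrier G \<Longrightarrow> y \<in> carrier G \<Longrightarrow> x \<otimes>\<^bsub>H\<^esub> y = x \<otimes>\<^bsub>G\<^esub> y"
    and trace: "{X \<inter> carrier G |X. X \<in> B} = A"
    and s_in: "X \<in> A \<Longrightarrow> s X \<in> B"
    and s_Int: "X \<in> A \<Longrightarrow> Y \<in> A \<Longrightarrow> s (X \<inter> Y) = s X \<inter> s Y"
    and s_compl: "X \<in> A \<Longrightarrow> s (carrier G - X) = carrier H - s X"
    and s_pull: "X \<in> A \<Longrightarrow> g \<in> carrier G \<Longrightarrow>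
      s {x \<in> carrier G. g \<otimes>\<^bsub>G\<^esub> x \<in> X} = {x \<in> carrier H. g \<otimes>\<^bsub>H\<^esub> x \<in> s X}"
begin

text \<open>Stone duality reverses arrows: \<open>emb\<close> is dual to the trace map from
  \<open>B\<close> to \<open>A\<close>, and \<open>restr\<close> below is dual to \<open>s\<close>
  from \<open>A\<close> to \<open>B\<close>.\<close>

definition emb where "emb p = {X \<in> B. X \<inter> carrier G \<in> p}"

definition restr where "restr x = {X \<in> A. s X \<in> x}"

lemma trace_in [simp]: "X \<in> B \<Longrightarrow> X \<inter> carrier G \<in> A"
  using trace by blast

lemma trace_pull:
  assumes "X \<in> B" "g \<in> carrier G"
  shows "H.pull g X \<inter> carrier G = G.pull g (X \<inter> carrier G)"
  using assms carrier_subset by (auto simp: mult_eq subset_eq)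

lemma emb_stone [simp]:
  assumes p: "p \<in> stone G A"
  shows "emb p \<in> stone H B"
proof (rule H.stoneI)
  show "{} \<notin> emb p" using G.stone_empty[OF p] by (simp add: emb_def)
  fix X Y assume XY: "X \<in> B" "Y \<in> B"
  have "X \<inter> Y \<inter> carrier G = (X \<inter> carrier G) \<inter> (Y \<inter> carrier G)" by blast
  then show "X \<inter> Y \<in> emb p \<longleftrightarrow> X \<in> emb p \<and> Y \<in> emb p"
    using XY G.stone_Int[OF p trace_in[OF XY(1)] trace_in[OF XY(2)]] by (simp add: emb_def)
next
  fix X assume X: "X \<in> B"
  have "(carrier H - X) \<inter> carrier G = carrier G - X \<inter> carrier G" using carrier_subset by blast
  then show "carrier H - X \<in> emb p \<longleftrightarrow> X \<notin> emb p"
    using X G.stone_compl[OF p trace_in[OF X]] by (simp add: emb_def)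
qed (simp add: emb_def)

text \<open>For \<open>g\<close> in the smaller group, pulling back by \<open>g\<close> commutes
  with taking traces. Multiplicativity of \<open>emb\<close> follows from this.\<close>

lemma trace_dmap_emb:
  assumes "X \<in> B" "p \<in> stone G A"
  shows "dmap H (emb p) X \<inter> carrier G = dmap G p (X \<inter> carrier G)"
  using assms carrier_subset by (auto simp: H.dmap_eq G.dmap_eq emb_def trace_pull subset_eq)

lemma emb_star:
  assumes "p \<in> stone G A" "q \<in> stone G A"
  shows "emb (star G A p q) = star H B (emb p) (emb q)"
  using assms
  by (auto simp: emb_def[of p] emb_def[of "star G A p q"] H.mem_star G.mem_star trace_dmap_emb)

lemma restr_stone:
  assumes x: "x \<in> stone H B"
  shows "restr x \<in> stone G A"
proof (rule G.stoneI)
  have "s {} = {}" using s_Int[of "{}" "carrier G"] s_compl[of "{}"] by auto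
  then show "{} \<notin> restr x" using H.stone_empty[OF x] by (simp add: restr_def)
qed (auto simp: restr_def s_Int s_compl s_in H.stone_Int[OF x] H.stone_compl[OF x])

text \<open>A left factor \<open>emb p\<close> only sees the part of \<open>dmap H x (s X)\<close>
  inside \<open>carrier G\<close>, and there \<open>s_pull\<close> moves translations through
  \<open>s\<close>.\<close>

lemma restr_star_emb:
  assumes "p \<in> stone G A" "x \<in> stone H B"
  shows "restr (star H B (emb p) x) = star G A p (restr x)"
proof -
  have "dmap H x (s X) \<inter> carrier G = dmap G (restr x) X" if "X \<in> A" for X
    using that carrier_subset by (auto simp: H.dmap_eq G.dmap_eq s_in restr_def s_pull subset_eq)
  then show ?thesis
    using assms by (auto simp: restr_def H.mem_star G.mem_star emb_def s_in)
qed

lemma continuous_emb: "continuous_map (stone_topology G A) (stone_topology H B) emb"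
proof (rule H.continuous_map_stoneI)
  fix X assume "X \<in> B"
  then show "openin (stone_topology G A) {p \<in> topspace (stone_topology G A). X \<in> emb p}"
    using G.openin_basic[OF trace_in] by (simp add: emb_def)
qed simp

section \<open>The embedding of Ellis groups\<close>

lemma ellis_group_embeds:
  assumes groups: "\<And>J. minimal_left_ideal H B J \<Longrightarrow> \<exists>e. group \<lparr>carrier = J, mult = star H B, one = e\<rparr>"
    and E: "is_ellis_group G A E"
  shows "\<exists>F K. is_ellis_group H B F \<and> subgroup K F \<and>
    closedin (subtopology (stone_topology H B) (carrier F)) K \<and> E \<cong> F\<lparr>carrier := K\<rparr>"
proof -
  obtain I u where I: "minimal_left_ideal G A I" and u: "u \<in> I" "star G A u u = u"
    and E_eq: "E = ellis_group G A u I"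
    using E by (auto simp: is_ellis_group_def)
  obtain J where J: "minimal_left_ideal H B J" using H.minimal_left_ideal_exists by blast
  then obtain v where "group \<lparr>carrier = J, mult = star H B, one = v\<rparr>" using groups by blast
  then interpret J: group "\<lparr>carrier = J, mult = star H B, one = v\<rparr>" .
  let ?F = "\<lparr>carrier = J, mult = star H B, one = v\<rparr>"
  have vJ: "v \<in> J" and v1: "\<And>x. x \<in> J \<Longrightarrow> star H B v x = x"
    using J.one_closed J.l_one by auto
  have JS: "\<And>x. x \<in> J \<Longrightarrow> x \<in> stone H B"
    and Jideal: "\<And>p x. p \<in> stone H B \<Longrightarrow> x \<in> J \<Longrightarrow> star H B p x \<in> J"
    using J by (auto simp: minimal_left_ideal_def left_ideal_def)
  have IS: "\<And>x. x \<in> I \<Longrightarrow> x \<in> stone G A"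
    and Iideal: "\<And>p x. p \<in> stone G A \<Longrightarrow> x \<in> I \<Longrightarrow> star G A p x \<in> I"
    using I by (auto simp: minimal_left_ideal_def left_ideal_def)
  define \<phi> where "\<phi> p = star H B (emb p) v" for p
  have \<phi>J: "\<phi> p \<in> J" if "p \<in> stone G A" for p using Jideal vJ that by (simp add: \<phi>_def)
  \<comment> \<open>The factor \<open>v\<close> missing between \<open>emb p\<close> and
    \<open>emb q\<close> may be inserted, because \<open>v\<close> is a left identity on
    \<open>J\<close> and \<open>\<phi> q\<close> lies in \<open>J\<close>.\<close>
  have \<phi>_mult: "\<phi> (star G A p q) = star H B (\<phi> p) (\<phi> q)" if "p \<in> stone G A" "q \<in> stone G A" for p q
    using that v1[OF \<phi>J[OF that(2)]] JS[OF vJ] JS[OF \<phi>J[OF that(2)]]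
    by (simp add: \<phi>_def emb_star H.star_assoc)
  have uS: "u \<in> stone G A" using IS u(1) .
  \<comment> \<open>The only idempotent of a group is its identity.\<close>
  have \<phi>u: "\<phi> u = v"
  proof -
    have "star H B (\<phi> u) (\<phi> u) = \<phi> u" using \<phi>_mult[OF uS uS] u(2) by simp
    then show ?thesis using J.l_cancel_one[of "\<phi> u" "\<phi> u"] \<phi>J[OF uS] by simp
  qed
  define U where "U = star G A u ` I"
  have US: "\<And>g. g \<in> U \<Longrightarrow> g \<in> stone G A" using G.ellis_subset[OF I u(1)] IS by (auto simp: U_def)
  have u_left: "star G A u g = g" if "g \<in> U" for g
    using that u IS by (auto simp: U_def simp flip: G.star_assoc)
  have U_mult: "star G A g h \<in> U" if "g \<in> U" "h \<in> U" for g h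
  proof -
    have "star G A g h = star G A u (star G A g h)"
      using that US uS u_left[OF that(1)] by (simp flip: G.star_assoc)
    moreover have "h \<in> I" using G.ellis_subset[OF I u(1)] that(2) by (auto simp: U_def)
    ultimately show ?thesis using Iideal US[OF that(1)] unfolding U_def by blast
  qed
  have uU: "u \<in> U" using u unfolding U_def by (metis imageI)
  have U_inv: "\<exists>h\<in>U. star G A h g = u" if "g \<in> U" for g
    using G.ellis_left_inverse[OF I u] that by (simp add: U_def del: image_iff)
  define K where "K = \<phi> ` U"
  \<comment> \<open>Placing \<open>p\<close> between two factors \<open>u\<close> moves it into the
    Ellis group without changing its image, since \<open>\<phi> u\<close> is the identity.\<close>
  have K_stone: "K = \<phi> ` stone G A"
  proof -
    have "\<phi> p \<in> \<phi> ` U" if p: "p \<in> stone G A" for p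
    proof -
      have "\<phi> (star G A u (star G A p u)) = \<phi> p"
        using p uS \<phi>J[OF p] v1 J.r_one[of "\<phi> p"] by (simp add: \<phi>_mult \<phi>u)
      moreover have "star G A u (star G A p u) \<in> U" using Iideal[OF p u(1)] by (simp add: U_def)
      ultimately show ?thesis by (metis imageI)
    qed
    then show ?thesis using US by (auto simp: K_def)
  qed
  \<comment> \<open>Multiplication by the left identity \<open>v\<close> maps \<open>J\<close> onto
    itself, so the minimal left ideal is itself an Ellis group.\<close>
  have F: "ellis_group H B v J = ?F"
    using v1 by (simp add: ellis_group_def)
  have "star H B v v = v" using v1 vJ by blast
  then have "is_ellis_group H B ?F"
    unfolding is_ellis_group_def using J vJ F by metis
  moreover have "subgroup K ?F"
  proof (rule J.subgroupI)
    show "K \<subseteq> carrier ?F" using \<phi>J US by (auto simp: K_def)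
    show "K \<noteq> {}" using uU by (auto simp: K_def)
    fix a assume "a \<in> K"
    then obtain g where g: "g \<in> U" "a = \<phi> g" by (auto simp: K_def)
    then obtain h where h: "h \<in> U" "star G A h g = u"
      using U_inv g(1) by blast
    \<comment> \<open>A left inverse suffices, because \<open>J\<close> is known to be a
      group.\<close>
    then have "star H B (\<phi> h) a = v" using g US \<phi>_mult \<phi>u by metis
    then have "inv\<^bsub>?F\<^esub> a = \<phi> h"
      using J.inv_equality[of "\<phi> h" a] g h \<phi>J US by simp
    then show "inv\<^bsub>?F\<^esub> a \<in> K" using h(1) by (simp add: K_def)
    fix b assume "b \<in> K"
    then obtain k where "k \<in> U" "b = \<phi> k" by (auto simp: K_def)
    then show "a \<otimes>\<^bsub>?F\<^esub> b \<in> K"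
      using g U_mult[of g k] \<phi>_mult[of g k] US by (auto simp: K_def)
  qed
  moreover have "closedin (subtopology (stone_topology H B) (carrier ?F)) K"
  proof -
    have "continuous_map (stone_topology G A) (stone_topology H B) \<phi>"
      using continuous_map_compose[OF continuous_emb H.continuous_star_left[OF JS[OF vJ]]]
      by (simp add: \<phi>_def[abs_def] comp_def)
    \<comment> \<open>Here \<open>K_stone\<close> matters: it presents \<open>K\<close> as a
      continuous image of a compact space.\<close>
    then have "compactin (stone_topology H B) K"
      using G.compact_stone image_compactin unfolding K_stone compact_space_def G.topspace_stone by blast
    then have "closedin (stone_topology H B) K" using compactin_imp_closedin[OF H.Hausdorff_stone] by blast
    moreover have "K \<subseteq> J" using \<phi>J K_stone by auto
    ultimately show ?thesis by (simp add: closedin_subset_topspace)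
  qed
  moreover have "E \<cong> ?F\<lparr>carrier := K\<rparr>"
  proof -
    have "g = h" if gh: "g \<in> U" "h \<in> U" "\<phi> g = \<phi> h" for g h
    proof -
      \<comment> \<open>A left inverse \<open>k\<close> of \<open>h\<close> reduces injectivity to
        the kernel: the product of \<open>k\<close> and \<open>g\<close> is sent to \<open>v\<close>
        and has to be shown equal to \<open>u\<close>.\<close>
      obtain k where k: "k \<in> U" "star G A k h = u"
        using U_inv gh(2) by blast
      have kg: "star G A k g \<in> U" using k gh U_mult by blast
      have "\<phi> (star G A k g) = v" using \<phi>_mult US k gh \<phi>u by metis
      then have "star G A (star G A k g) (restr v) = restr v"
        using restr_star_emb[OF US[OF kg] JS[OF vJ]] by (simp add: \<phi>_def)
      \<comment> \<open>Right multiplication by \<open>u\<close> moves the fixed point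
        \<open>restr v\<close> into \<open>I\<close>, as \<open>ellis_fixed_imp_one\<close>
        demands.\<close>
      then have "star G A (star G A k g) (star G A (restr v) u) = star G A (restr v) u"
        using restr_stone[OF JS[OF vJ]] US[OF kg] uS by (simp flip: G.star_assoc)
      moreover have "star G A (restr v) u \<in> I" using Iideal restr_stone[OF JS[OF vJ]] u(1) by blast
      ultimately have kgu: "star G A k g = u"
        using G.ellis_fixed_imp_one[OF I u] kg unfolding U_def by blast
      \<comment> \<open>Cancelling \<open>k\<close> on the left takes a left inverse of
        \<open>k\<close> itself.\<close>
      obtain l where l: "l \<in> U" "star G A l k = u"
        using U_inv k(1) by blast
      have "g = star G A (star G A l k) g" using l u_left gh by simp
      also have "\<dots> = star G A l (star G A k g)"
        by (rule G.star_assoc) (use k l US gh in blast)+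
      also have "\<dots> = star G A l (star G A k h)" using kgu k(2) by simp
      also have "\<dots> = star G A (star G A l k) h"
        by (rule G.star_assoc[symmetric]) (use k l US gh in blast)+
      also have "\<dots> = h" using l u_left gh by simp
      finally show ?thesis .
    qed
    then have "inj_on \<phi> U" by (auto simp: inj_on_def)
    then have "\<phi> \<in> iso E (?F\<lparr>carrier := K\<rparr>)"
      unfolding E_eq iso_def hom_def ellis_group_def bij_betw_def
      using \<phi>_mult US by (auto simp: K_def U_def[symmetric])
    then show ?thesis unfolding is_iso_def by blast
  qed
  ultimately show ?thesis by blast
qed

end


section \<open>Elementary extensions of groups\<close>

lemma struct_group_simps [simp]:
  "carrier (struct_group m M) = univ M"
  "x \<otimes>\<^bsub>struct_group m M\<^esub> y = fint M m [x, y]"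
  by (simp_all add: struct_group_def)

lemma elementary_ext_sat:
  "elementary_ext L M N \<Longrightarrow> wf_form L \<phi> \<Longrightarrow> range e \<subseteq> univ M \<Longrightarrow> sat M e \<phi> \<longleftrightarrow> sat N e \<phi>"
  by (simp add: elementary_ext_def)

lemma elementary_ext_subset: "elementary_ext L M N \<Longrightarrow> univ M \<subseteq> univ N"
  by (simp add: elementary_ext_def substruct_def)

lemma fint_closed:
  "is_struct L M \<Longrightarrow> (m, 2) \<in> funs L \<Longrightarrow> x \<in> univ M \<Longrightarrow> y \<in> univ M \<Longrightarrow> fint M m [x, y] \<in> univ M"
  unfolding is_struct_def by force

lemma fint_substruct:
  "substruct L M N \<Longrightarrow> (m, 2) \<in> funs L \<Longrightarrow> x \<in> univ M \<Longrightarrow> y \<in> univ M \<Longrightarrow>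
    fint N m [x, y] = fint M m [x, y]"
  unfolding substruct_def by force

text \<open>The group laws are first-order statements in \<open>m\<close> with the identity of the
  smaller group as a parameter, so they pass to the elementary extension.\<close>

lemma group_struct_group_elementary:
  fixes M N :: "('a, 'f, 'r) fo_struct"
  assumes m: "(m, 2) \<in> funs L" and NM: "elementary_ext L M N" and "group (struct_group m M)"
  shows "group (struct_group m N)"
proof -
  interpret G: group "struct_group m M" by fact
  define o1 where "o1 = \<one>\<^bsub>struct_group m M\<^esub>"
  have o1: "o1 \<in> univ M" using G.one_closed by (simp add: o1_def)
  then have o1N: "o1 \<in> univ N" using elementary_ext_subset[OF NM] by blast
  have m': "(m, Suc (Suc 0)) \<in> funs L" using m by (simp add: numeral_2_eq_2)
  \<comment> \<open>Under this constant assignment every variable left free denotes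
    \<open>o1\<close>: \<open>Var 1\<close> in the two identity laws, \<open>Var 2\<close> in the
    law of inverses.\<close>
  have transfer: "sat M (\<lambda>_. o1) \<phi> \<longleftrightarrow> sat N (\<lambda>_. o1) \<phi>" if "wf_form L \<phi>" for \<phi>
    by (rule elementary_ext_sat[OF NM that]) (use o1 in auto)
  have closed: "fint N m [x, y] \<in> univ N" if "x \<in> univ N" "y \<in> univ N" for x y
    using fint_closed[OF _ m] NM that by (auto simp: elementary_ext_def substruct_def)
  have assoc: "fint N m [fint N m [x, y], z] = fint N m [x, fint N m [y, z]]"
    if "x \<in> univ N" "y \<in> univ N" "z \<in> univ N" for x y z
    using transfer[of "Neg (Ex 0 (Ex 1 (Ex 2 (Neg
        (Eq (App m [App m [Var 0, Var 1], Var 2]) (App m [Var 0, App m [Var 1, Var 2]]))))))"]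
      G.m_assoc m' that by auto
  have l_one: "fint N m [o1, x] = x" if "x \<in> univ N" for x
    using transfer[of "Neg (Ex 0 (Neg (Eq (App m [Var 1, Var 0]) (Var 0))))"]
      G.l_one m' that by (auto simp: o1_def)
  have r_one: "fint N m [x, o1] = x" if "x \<in> univ N" for x
    using transfer[of "Neg (Ex 0 (Neg (Eq (App m [Var 0, Var 1]) (Var 0))))"]
      G.r_one m' that by (auto simp: o1_def)
  have inv: "\<exists>y\<in>univ N. fint N m [y, x] = o1" if "x \<in> univ N" for x
    using transfer[of "Neg (Ex 0 (Neg (Ex 1 (Eq (App m [Var 1, Var 0]) (Var 2)))))"]
      G.l_inv_ex m' that by (auto simp: o1_def)
  have one: "\<one>\<^bsub>struct_group m N\<^esub> = o1"
    unfolding struct_group_def monoid.simps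
    by (rule the_equality) (use l_one r_one o1N in \<open>blast, metis\<close>)
  show ?thesis
    by (rule groupI) (use closed assoc l_one inv o1N in \<open>simp_all add: one\<close>)
qed

section \<open>Boolean operations and translations of definable sets\<close>

lemma defset_Neg: "defset M e (Neg \<phi>) = univ M - defset M e \<phi>"
  by (auto simp: defset_def)

text \<open>The two formulas may use the same variables for different parameters, so these are moved to
  the even and to the odd positions of a common assignment.\<close>

lemma sharp_Int:
  fixes M N :: "('a, 'f, 'r) fo_struct"
  assumes NM: "elementary_ext L M N" and "X \<in> Def L M" "Y \<in> Def L M"
  shows "sharp L M N (X \<inter> Y) = sharp L M N X \<inter> sharp L M N Y"
proof -
  obtain e \<phi> where X: "X = defset M e \<phi>" "wf_form L \<phi>" "range e \<subseteq> univ M"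
    using assms by (auto simp: Def_def)
  obtain e' \<psi> where Y: "Y = defset M e' \<psi>" "wf_form L \<psi>" "range e' \<subseteq> univ M"
    using assms by (auto simp: Def_def)
  \<comment> \<open>Both renamings fix 0, since variable 0 stands for the tested element in either
    formula. For \<open>k > 0\<close>, parameter \<open>k\<close> of \<open>e\<close> moves to
    \<open>2 * k\<close> and that of \<open>e'\<close> to \<open>2 * k - 1\<close>.\<close>
  define \<rho> \<sigma> where "\<rho> n = 2 * n" and "\<sigma> n = (if n = 0 then 0 else 2 * n - 1)" for n :: nat
  define d where "d n = (if even n then e (n div 2) else e' (Suc n div 2))" for n
  have inj: "inj \<rho>" "inj \<sigma>"
    unfolding \<rho>_def \<sigma>_def inj_def by (simp_all, presburger)
  have d\<rho>: "(\<lambda>n. (d(0 := x)) (\<rho> n)) = e(0 := x)" for x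
    by (auto simp: fun_eq_iff d_def \<rho>_def)
  have d\<sigma>: "(\<lambda>n. (d(0 := x)) (\<sigma> n)) = e'(0 := x)" for x
  proof
    fix n show "(d(0 := x)) (\<sigma> n) = (e'(0 := x)) n"
      by (cases n) (auto simp: d_def \<sigma>_def)
  qed
  define \<chi> where "\<chi> = And (ren_form \<rho> \<phi>) (ren_form \<sigma> \<psi>)"
  have \<chi>: "wf_form L \<chi>" "range d \<subseteq> univ M"
    using X Y by (auto simp: \<chi>_def d_def wf_ren_form)
  have "defset K d \<chi> = defset K e \<phi> \<inter> defset K e' \<psi>" for K :: "('a, 'f, 'r) fo_struct"
    unfolding \<chi>_def defset_def
    by (auto simp: sat_ren_form inj d\<rho> d\<sigma> simp del: fun_upd_apply)
  then show ?thesis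
    using sharp_defset[OF NM \<chi>] sharp_defset[OF NM X(2,3)] sharp_defset[OF NM Y(2,3)] X(1) Y(1)
    by simp
qed

lemma sharp_compl:
  assumes NM: "elementary_ext L M N" and "X \<in> Def L M"
  shows "sharp L M N (univ M - X) = univ N - sharp L M N X"
proof -
  obtain e \<phi> where X: "X = defset M e \<phi>" "wf_form L \<phi>" "range e \<subseteq> univ M"
    using assms by (auto simp: Def_def)
  then show ?thesis
    using sharp_defset[OF NM, of "Neg \<phi>" e] sharp_defset[OF NM, of \<phi> e] by (simp add: defset_Neg)
qed

text \<open>Instead of substituting a term into the formula defining \<open>X\<close>, a quantified
  variable names the product, with \<open>g\<close> as a parameter. One formula then defines the
  preimage in both structures.\<close>

lemma sharp_pull:
  fixes M N :: "('a, 'f, 'r) fo_struct"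
  assumes m: "(m, 2) \<in> funs L" and NM: "elementary_ext L M N" and "X \<in> Def L M" and g: "g \<in> univ M"
  shows "sharp L M N {x \<in> univ M. fint M m [g, x] \<in> X} =
    {x \<in> univ N. fint N m [g, x] \<in> sharp L M N X}"
proof -
  obtain e \<phi> where X: "X = defset M e \<phi>" "wf_form L \<phi>" "range e \<subseteq> univ M"
    using assms by (auto simp: Def_def)
  \<comment> \<open>Variable 0 is kept for the argument, 1 for the product and 2 for
    \<open>g\<close>; so variable 0 of the given formula becomes 1 and its parameters move up by
    two. The values of \<open>d\<close> at 0 and 1 are placeholders, overwritten before use.\<close>
  define \<rho> :: "nat \<Rightarrow> nat" where "\<rho> n = (if n = 0 then 1 else n + 2)" for n
  define d where "d n = (if n \<le> 2 then g else e (n - 2))" for n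
  define \<psi> where "\<psi> = Ex 1 (And (Eq (Var 1) (App m [Var 2, Var 0])) (ren_form \<rho> \<phi>))"
  have inj: "inj \<rho>" by (auto simp: \<rho>_def inj_def)
  have d\<rho>: "(\<lambda>n. (d(0 := x, 1 := y)) (\<rho> n)) = e(0 := y)" for x y
    by (auto simp: fun_eq_iff d_def \<rho>_def)
  have \<psi>: "wf_form L \<psi>" "range d \<subseteq> univ M"
    using X g m by (auto simp: \<psi>_def d_def wf_ren_form numeral_2_eq_2)
  have sat\<psi>: "sat K (d(0 := x)) \<psi> \<longleftrightarrow> fint K m [g, x] \<in> defset K e \<phi>"
    for K :: "('a, 'f, 'r) fo_struct" and x
  proof -
    have "sat K (d(0 := x)) \<psi> \<longleftrightarrow>
      (\<exists>y\<in>univ K. y = fint K m [g, x] \<and> sat K (e(0 := y)) \<phi>)"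
      unfolding \<psi>_def sat.simps sat_ren_form[OF inj] d\<rho> by (simp add: d_def)
    then show ?thesis by (auto simp: defset_def)
  qed
  have "defset K d \<psi> = {x \<in> univ K. fint K m [g, x] \<in> defset K e \<phi>}" for K :: "('a, 'f, 'r) fo_struct"
    unfolding defset_def[of K d] sat\<psi> ..
  then show ?thesis
    using sharp_defset[OF NM \<psi>] sharp_defset[OF NM X(2,3)] X(1) by simp
qed

theorem theorem3p1:
  fixes L :: "('f, 'r) language"
    and M N :: "('a, 'f, 'r) fo_struct"
    and m :: 'f
    and G H :: "'a monoid"
    and \<A> \<B> :: "'a set set"
  assumes "(m, 2) \<in> funs L"
    and "is_struct L M"
    and "G = struct_group m M"
    and "group G"
    and "infinite (carrier G)"
    and "elementary_ext L M N"
    and "H = struct_group m N"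
    and "\<A> \<subseteq> Def L M"
    and "d_closed_algebra G \<A>"
    and "d_closed_algebra H \<B>"
    and "\<forall>A\<in>\<A>. sharp L M N A \<in> \<B>"
    and "{B \<inter> carrier G | B. B \<in> \<B>} = \<A>"
    and "\<forall>I. minimal_left_ideal H \<B> I \<longrightarrow>
               (\<exists>e. group \<lparr>carrier = I, mult = star H \<B>, one = e\<rparr>)"
  shows "\<forall>E. is_ellis_group G \<A> E \<longrightarrow>
           (\<exists>F K. is_ellis_group H \<B> F \<and> subgroup K F \<and>
                  closedin (subtopology (stone_topology H \<B>) (carrier F)) K \<and>
                  E \<cong> F\<lparr>carrier := K\<rparr>)"
proof (intro allI impI)
  fix E assume E: "is_ellis_group G \<A> E"
  have H: "group H"
    unfolding assms(7) by (rule group_struct_group_elementary) (use assms in auto)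
  have Def: "X \<in> Def L M" if "X \<in> \<A>" for X using assms(8) that by blast
  have sub: "substruct L M N" using assms(6) by (simp add: elementary_ext_def)
  \<comment> \<open>The laws of \<open>sharp\<close> hold on \<open>\<A>\<close> because its members
    are definable.\<close>
  interpret d_algebra_extension G \<A> H \<B> "sharp L M N"
  proof (intro d_algebra_extension.intro d_algebra.intro d_algebra_axioms.intro
      d_algebra_extension_axioms.intro)
    show "carrier G \<subseteq> carrier H"
      using elementary_ext_subset[OF assms(6)] by (simp add: assms(3,7))
    show "x \<otimes>\<^bsub>H\<^esub> y = x \<otimes>\<^bsub>G\<^esub> y" if "x \<in> carrier G" "y \<in> carrier G" for x y
      using fint_substruct[OF sub assms(1)] that by (simp add: assms(3,7))
    show "sharp L M N (X \<inter> Y) = sharp L M N X \<inter> sharp L M N Y" if "X \<in> \<A>" "Y \<in> \<A>" for X Y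
      using sharp_Int[OF assms(6)] Def that by blast
    show "sharp L M N (carrier G - X) = carrier H - sharp L M N X" if "X \<in> \<A>" for X
      using sharp_compl[OF assms(6)] Def that by (simp add: assms(3,7))
    show "sharp L M N {x \<in> carrier G. g \<otimes>\<^bsub>G\<^esub> x \<in> X} =
        {x \<in> carrier H. g \<otimes>\<^bsub>H\<^esub> x \<in> sharp L M N X}" if "X \<in> \<A>" "g \<in> carrier G" for X g
      using sharp_pull[OF assms(1,6)] Def that by (simp add: assms(3,7))
  qed (use assms H in auto)
  show "\<exists>F K. is_ellis_group H \<B> F \<and> subgroup K F \<and>
      closedin (subtopology (stone_topology H \<B>) (carrier F)) K \<and> E \<cong> F\<lparr>carrier := K\<rparr>"
    using ellis_group_embeds assms(13) E by blast
qed

end
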